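(* Let $d\in\mathbb{N}$ and let $\phi_{1},\phi_{2}\colon (0,\infty)\to (0,\infty)$ be increasing, concave functions with $\phi_{1}(R)\in o(\phi_{2}(R))$. Then $\phi_{2}$-displacement equivalence of separated nets in $\mathbb{R}^{d}$ is a strictly weaker notion than $\phi_{1}$-displacement equivalence; that is, any two $\phi_1$-displacement equivalent separated nets in $\mathbb{R}^d$ are $\phi_2$-displacement equivalent, and there exist two separated nets in $\mathbb{R}^d$ which are $\phi_2$-displacement equivalent but not $\phi_1$-displacement equivalent.
   Context: A set $Z\subseteq\mathbb{R}^d$ is separated if $\inf\{\|z-z'\|_2: z,z'\in Z,\ z\ne z'\}>0$, and a net of $\mathbb{R}^d$ if $\sup_{x\in\mathbb{R}^d}\inf_{z\in Z}\|z-x\|_2<\infty$; a separated net is a set that is both. A function $\phi$ is increasing if $s\le t$ implies $\phi(s)\le\phi(t)$. For $f\colon A\subseteq\mathbb{R}^d\to\mathbb{R}^d$ and $R>0$, $\operatorname{disp}_R(f):=\sup\{\|f(x)-x\|_2: x\in A,\ \|x\|_2\le R\}$, with $\operatorname{disp}_R(f):=0$ if $A\cap\overline{B}(\mathbf{0},R)=\emptyset$. Asymptotic notation is for $R\to\infty$: $u(R)\in O(v(R))$ means $\limsup_{R\to\infty}u(R)/v(R)<\infty$ and $u(R)\in o(v(R))$ means $\limsup_{R\to\infty}u(R)/v(R)=0$. For an increasing, concave function $\phi\colon(0,\infty)\to(0,\infty)$, separated nets $X,Y\subseteq\mathbb{R}^d$ are called $\phi$-displacement equivalent if there is a bijection $f\colon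 X\to Y$ with $\operatorname{disp}_R(f)\in O(\phi(R))$. *)

theory Defs
  imports "HOL-Analysis.Analysis" "HOL-Library.Landau_Symbols"
begin

text \<open>
  Infima and suprema of distances are taken in \<^typ>\<open>ereal\<close>, so that the infimum over an
  empty index set is infinite; in particular the empty set is not a net.
\<close>

definition separated_set :: "(real ^ 'n) set \<Rightarrow> bool" where
  "separated_set Z \<longleftrightarrow> 0 < (INF (z, z') \<in> {(z, z') \<in> Z \<times> Z. z \<noteq> z'}. ereal (norm (z - z')))"

definition net :: "(real ^ 'n) set \<Rightarrow> bool" where
  "net Z \<longleftrightarrow> (SUP x. INF z\<in>Z. ereal (norm (z - x))) < \<infinity>"

definition separated_net :: "(real ^ 'n) set \<Rightarrow> bool" where
  "separated_net Z \<longleftrightarrow> separated_set Z \<and> net Z"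

text \<open>
  The domain of \<open>f\<close> is passed explicitly. The supremum is taken in \<^typ>\<open>real\<close>; for separated
  \<open>A\<close> it ranges over a finite set (lemma \<open>finite_separated_cball\<close>), so it is a maximum.
\<close>

definition disp :: "(real ^ 'n) set \<Rightarrow> (real ^ 'n \<Rightarrow> real ^ 'n) \<Rightarrow> real \<Rightarrow> real" where
  "disp A f R =
     (if A \<inter> cball 0 R = {} then 0 else SUP x \<in> A \<inter> cball 0 R. norm (f x - x))"

definition displacement_equivalent ::
    "(real \<Rightarrow> real) \<Rightarrow> (real ^ 'n) set \<Rightarrow> (real ^ 'n) set \<Rightarrow> bool" where
  "displacement_equivalent \<phi> X Y \<longleftrightarrow>
     (\<exists>f. bij_betw f X Y \<and> (\<lambda>R. disp X f R) \<in> O[at_top](\<phi>))"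

lemma separated_set_iff_uniform_discrete: "separated_set Z \<longleftrightarrow> uniform_discrete Z"
proof
  assume "separated_set Z"
  then obtain e where e: "0 < ereal e"
    "ereal e < (INF (z, z') \<in> {(z, z') \<in> Z \<times> Z. z \<noteq> z'}. ereal (norm (z - z')))"
    unfolding separated_set_def using ereal_dense2[of 0] by blast
  have "e \<le> norm (z - z')" if "z \<in> Z" "z' \<in> Z" "z \<noteq> z'" for z z'
  proof -
    have "ereal e < ereal (norm (z - z'))"
      by (rule less_le_trans[OF e(2)], rule INF_lower2[of "(z, z')"]) (use that in auto)
    then show ?thesis by simp
  qed
  then show "uniform_discrete Z"
    using e(1) unfolding uniform_discrete_def dist_norm by fastforce
next
  assume "uniform_discrete Z"
  then obtain e where e: "e > 0" "\<And>z z'. z \<in> Z \<Longrightarrow> z' \<in> Z \<Longrightarrow> norm (z - z') < e \<Longrightarrow> z = z'"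
    unfolding uniform_discrete_def dist_norm by metis
  have "ereal e \<le> (INF (z, z') \<in> {(z, z') \<in> Z \<times> Z. z \<noteq> z'}. ereal (norm (z - z')))"
    by (rule INF_greatest) (use e(2) in force)
  then show "separated_set Z"
    unfolding separated_set_def using e(1) by (meson ereal_less(2) less_le_trans)
qed

lemma finite_separated_cball:
  assumes "separated_set A" shows "finite (A \<inter> cball 0 R)"
proof -
  have "uniform_discrete (A \<inter> cball 0 R)"
    using assms unfolding separated_set_iff_uniform_discrete uniform_discrete_def by blast
  then show ?thesis
    using uniform_discrete_finite_iff bounded_Int bounded_cball by blast
qed

end

theory Submission imports Defs begin

text \<open>
  An equivalence with displacement \<open>\<phi>\<^sub>1\<close> is one with displacement \<open>\<phi>\<^sub>2\<close> because \<open>o(\<phi>\<^sub>2)\<close> is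
  contained in \<open>O(\<phi>\<^sub>2)\<close>. To see that the converse fails, compare the integer lattice \<open>X\<close> with the
  set \<open>Y\<close> obtained by pushing every nonzero coordinate \<open>t\<close> away from the origin by \<open>\<phi>\<^sub>2 \<bar>t\<bar>\<close>. The push is
  expanding and, as \<open>\<phi>\<^sub>2\<close> is concave, it leaves only bounded gaps; so \<open>Y\<close> is a separated net, and the
  push itself is a bijection of displacement \<open>O(\<phi>\<^sub>2)\<close>.

  That no bijection \<open>f\<close> from \<open>X\<close> to \<open>Y\<close> has displacement at most \<open>C * \<phi>\<^sub>1\<close> follows by counting points
  in a ball. A point of norm at least \<open>R\<close> is pushed to a point of norm at least \<open>R + c * \<phi>\<^sub>2 R\<close>
  (lemma \<open>norm_push_ge\<close>), which exceeds \<open>R + C * \<phi>\<^sub>1 R\<close> when \<open>R\<close> is large. Hence \<open>f\<close> would map the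
  lattice points of the closed ball of radius \<open>R\<close> injectively to pushed lattice points of the open
  ball, and these are strictly fewer if \<open>R\<close> is an integer, because the lattice then meets the sphere
  of radius \<open>R\<close>.
\<close>

section \<open>Positive concave functions on the half-line\<close>

text \<open>
  On the closed half-line one could take the factor \<open>1 / c\<close>, by comparing with the value at 0. Here 0
  is not in the domain, so half of the weight goes to an auxiliary positive point.
\<close>

lemma concave_pos_scale:
  fixes \<phi> :: "real \<Rightarrow> real"
  assumes pos: "\<And>t. t > 0 \<Longrightarrow> \<phi> t > 0" and conc: "concave_on {0<..} \<phi>"
    and "c \<ge> 1" and "r > 0"
  shows "\<phi> r / (2 * c) \<le> \<phi> (r / c)"
proof -
  define l where "l = 1 / (2 * c)"
  define s where "s = (r / (2 * c)) / (1 - l)"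
  have l: "0 < l" "l < 1" using \<open>c \<ge> 1\<close> by (auto simp: l_def)
  have s: "s > 0" using l \<open>r > 0\<close> \<open>c \<ge> 1\<close> by (simp add: s_def)
  have "(1 - l) * s = r / (2 * c)" using l by (simp add: s_def)
  then have eq: "(1 - l) * s + l * r = r / c" using \<open>c \<ge> 1\<close> by (simp add: l_def field_simps)
  have "(1 - l) * \<phi> s + l * \<phi> r \<le> \<phi> ((1 - l) * s + l * r)"
    using concave_onD[OF conc, of l s r] l s \<open>r > 0\<close> by simp
  moreover have "(1 - l) * \<phi> s \<ge> 0" using l pos[OF s] by simp
  ultimately show ?thesis unfolding eq by (simp add: l_def)
qed

lemma concave_increment_le:
  fixes \<phi> :: "real \<Rightarrow> real"
  assumes conc: "concave_on {0<..} \<phi>" and "t \<ge> 1"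
  shows "\<phi> (t + 1) - \<phi> t \<le> 2 * (\<phi> 1 - \<phi> (1/2))"
proof -
  have conv: "convex_on {0<..} (\<lambda>t. - \<phi> t)" using conc by (simp add: concave_on_def)
  have 1: "\<phi> (t + 1) - \<phi> t \<le> (\<phi> t - \<phi> (1/2)) / (t - 1/2)"
    using convex_on_slope_le[OF conv, of "1/2" "t + 1" t] \<open>t \<ge> 1\<close> by (simp add: field_simps)
  have 2: "(\<phi> t - \<phi> (1/2)) / (t - 1/2) \<le> 2 * (\<phi> 1 - \<phi> (1/2))"
  proof (cases "t = 1")
    case False
    then show ?thesis
      using convex_on_slope_le[OF conv, of "1/2" t 1] \<open>t \<ge> 1\<close> by (simp add: field_simps)
  qed simp
  from 1 2 show ?thesis by linarith
qed

section \<open>Images of the integer lattice under coordinatewise maps\<close>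

definition integer_lattice :: "(real ^ 'n) set" where
  "integer_lattice = {x. \<forall>i. x $ i \<in> \<int>}"

definition coordinatewise :: "(real \<Rightarrow> real) \<Rightarrow> real ^ 'n \<Rightarrow> real ^ 'n" where
  "coordinatewise G x = (\<chi> i. G (x $ i))"

lemma separated_net_coordinatewise:
  fixes G :: "real \<Rightarrow> real"
  assumes sep: "\<And>s t. s \<in> \<int> \<Longrightarrow> t \<in> \<int> \<Longrightarrow> s \<noteq> t \<Longrightarrow> \<bar>G s - G t\<bar> \<ge> 1"
    and dense: "\<And>y. \<exists>k\<in>\<int>. \<bar>G k - y\<bar> \<le> L"
  shows "separated_net (coordinatewise G ` (integer_lattice :: (real ^ 'n) set))"
proof -
  let ?Y = "coordinatewise G ` (integer_lattice :: (real ^ 'n) set)"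
  have "uniform_discrete ?Y"
    unfolding uniform_discrete_def
  proof (intro exI[of _ 1] conjI ballI impI)
    fix u v assume uv: "u \<in> ?Y" "v \<in> ?Y" and lt: "dist u v < 1"
    obtain x y :: "real ^ 'n" where x: "x \<in> integer_lattice" "u = coordinatewise G x"
      and y: "y \<in> integer_lattice" "v = coordinatewise G y" using uv by auto
    have "x $ i = y $ i" for i
    proof (rule ccontr)
      assume "x $ i \<noteq> y $ i"
      then have "1 \<le> \<bar>G (x $ i) - G (y $ i)\<bar>"
        using sep x y by (auto simp: integer_lattice_def)
      also have "\<dots> = \<bar>(u - v) $ i\<bar>" by (simp add: x y coordinatewise_def)
      also have "\<dots> \<le> norm (u - v)" by (rule component_le_norm_cart)
      finally show False using lt by (simp add: dist_norm)
    qed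
    then have "x = y" by (simp add: vec_eq_iff)
    then show "u = v" by (simp add: x y)
  qed simp
  moreover have "net ?Y"
  proof -
    have "(INF z\<in>?Y. ereal (norm (z - y))) \<le> ereal (real CARD('n) * L)" for y :: "real ^ 'n"
    proof -
      obtain k where k: "\<And>i. k i \<in> \<int>" "\<And>i. \<bar>G (k i) - y $ i\<bar> \<le> L"
        using dense[of "y $ _"] by metis
      define z :: "real ^ 'n" where "z = coordinatewise G (\<chi> i. k i)"
      have "norm (z - y) \<le> (\<Sum>i\<in>UNIV. \<bar>(z - y) $ i\<bar>)" by (rule norm_le_l1_cart)
      also have "\<dots> \<le> (\<Sum>i\<in>(UNIV :: 'n set). L)"
        by (rule sum_mono) (simp add: z_def coordinatewise_def k)
      finally have "norm (z - y) \<le> real CARD('n) * L" by simp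
      moreover have "z \<in> ?Y" by (auto simp: z_def integer_lattice_def k)
      ultimately show ?thesis by (auto intro!: INF_lower2)
    qed
    then have "(SUP y. INF z\<in>?Y. ereal (norm (z - y))) \<le> ereal (real CARD('n) * L)"
      by (rule SUP_least)
    then show ?thesis by (auto simp: net_def intro: le_less_trans)
  qed
  ultimately show ?thesis by (simp add: separated_net_def separated_set_iff_uniform_discrete)
qed

lemma separated_net_integer_lattice: "separated_net (integer_lattice :: (real ^ 'n) set)"
proof -
  have "separated_net (coordinatewise (\<lambda>t. t) ` (integer_lattice :: (real ^ 'n) set))"
  proof (rule separated_net_coordinatewise[where L = 1])
    fix s t :: real assume "s \<in> \<int>" "t \<in> \<int>" "s \<noteq> t"
    then show "\<bar>s - t\<bar> \<ge> 1" by (metis Ints_diff Ints_nonzero_abs_ge1 right_minus_eq)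
  next
    fix y :: real
    show "\<exists>k\<in>\<int>. \<bar>k - y\<bar> \<le> 1"
      by (rule bexI[of _ "of_int \<lfloor>y\<rfloor>"]) (linarith, simp)
  qed
  then show ?thesis by (simp add: coordinatewise_def)
qed

lemma separated_set_integer_lattice: "separated_set integer_lattice"
  by (rule conjunct1[OF separated_net_integer_lattice[unfolded separated_net_def]])

section \<open>Pushing the coordinates outwards\<close>

definition push :: "(real \<Rightarrow> real) \<Rightarrow> real \<Rightarrow> real" where
  "push \<phi> t = t + sgn t * \<phi> \<bar>t\<bar>"

lemma push_expanding:
  fixes \<phi> :: "real \<Rightarrow> real"
  assumes pos: "\<And>t. t > 0 \<Longrightarrow> \<phi> t > 0" and mono: "mono_on {0<..} \<phi>"
  shows "\<bar>push \<phi> s - push \<phi> t\<bar> \<ge> \<bar>s - t\<bar>"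
proof -
  have *: "push \<phi> t - push \<phi> s \<ge> t - s" if "s < t" for s t
  proof -
    have "sgn s * \<phi> \<bar>s\<bar> \<le> sgn t * \<phi> \<bar>t\<bar>"
      using that mono_onD[OF mono, of s t] mono_onD[OF mono, of "- t" "- s"]
        pos[of s] pos[of t] pos[of "- s"] pos[of "- t"]
      by (auto simp: sgn_if)
    then show ?thesis by (simp add: push_def)
  qed
  show ?thesis using *[of s t] *[of t s] by (cases s t rule: linorder_cases) auto
qed

text \<open>
  The nonnegative target \<open>y\<close> lies in one of the gaps between consecutive values of \<open>push \<phi>\<close> at natural
  numbers, all of which are bounded; the gap after 0 needs its own bound \<open>1 + \<phi> 1\<close>, since \<open>push \<phi>\<close>
  jumps there. Negative targets follow by symmetry.
\<close>

lemma push_dense: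
  fixes \<phi> :: "real \<Rightarrow> real"
  assumes pos: "\<And>t. t > 0 \<Longrightarrow> \<phi> t > 0" and mono: "mono_on {0<..} \<phi>"
    and conc: "concave_on {0<..} \<phi>"
  shows "\<exists>k\<in>\<int>. \<bar>push \<phi> k - y\<bar> \<le> 1 + \<phi> 1 + 2 * (\<phi> 1 - \<phi> (1/2))"
proof -
  let ?L = "1 + \<phi> 1 + 2 * (\<phi> 1 - \<phi> (1/2))"
  have p1: "\<phi> 1 > 0" "\<phi> 1 \<ge> \<phi> (1/2)" using pos mono_onD[OF mono, of "1/2" 1] by auto
  have gap: "push \<phi> (real (Suc n)) - push \<phi> (real n) \<le> ?L" for n
  proof (cases n)
    case 0
    then show ?thesis using p1 by (simp add: push_def)
  next
    case (Suc m)
    then show ?thesis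
      using concave_increment_le[OF conc, of "real n"] p1 by (simp add: push_def add.commute)
  qed
  have nonneg: "\<exists>n. \<bar>push \<phi> (real n) - y\<bar> \<le> ?L" if "y \<ge> 0" for y
  proof -
    have ge: "push \<phi> (real n) \<ge> real n" for n
      using pos[of "real n"] by (cases "n = 0") (auto simp: push_def)
    obtain m where "y \<le> real m" using real_arch_simple by blast
    then have ex: "y \<le> push \<phi> (real m)" using ge[of m] by linarith
    define n where "n = (LEAST n. y \<le> push \<phi> (real n))"
    have n: "y \<le> push \<phi> (real n)" unfolding n_def by (rule LeastI) (rule ex)
    show ?thesis
    proof (cases n)
      case 0
      then show ?thesis using n that p1 by (intro exI[of _ 0]) (simp add: push_def)
    next
      case (Suc l)
      then have "push \<phi> (real l) < y"
        using not_less_Least[of l "\<lambda>n. y \<le> push \<phi> (real n)"] by (simp add: n_def not_le)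
      then show ?thesis using gap[of l] n Suc by (intro exI[of _ n]) auto
    qed
  qed
  show ?thesis
  proof (cases "y \<ge> 0")
    case True
    then show ?thesis using nonneg by (metis Ints_of_nat)
  next
    case False
    then obtain n where "\<bar>push \<phi> (real n) - (- y)\<bar> \<le> ?L" using nonneg[of "- y"] by auto
    moreover have "push \<phi> (- real n) = - push \<phi> (real n)" by (simp add: push_def sgn_minus)
    ultimately show ?thesis by (intro bexI[of _ "- real n"]) auto
  qed
qed

lemma norm_push_diff_le:
  fixes x :: "real ^ 'n" and \<phi> :: "real \<Rightarrow> real"
  assumes pos: "\<And>t. t > 0 \<Longrightarrow> \<phi> t > 0" and mono: "mono_on {0<..} \<phi>"
    and "norm x \<le> R" "R > 0"
  shows "norm (coordinatewise (push \<phi>) x - x) \<le> real CARD('n) * \<phi> R"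
proof -
  have "norm (coordinatewise (push \<phi>) x - x) \<le> (\<Sum>i\<in>UNIV. \<bar>(coordinatewise (push \<phi>) x - x) $ i\<bar>)"
    by (rule norm_le_l1_cart)
  also have "\<dots> \<le> (\<Sum>i\<in>(UNIV :: 'n set). \<phi> R)"
  proof (rule sum_mono)
    fix i :: 'n
    have "\<bar>x $ i\<bar> \<le> R" using component_le_norm_cart[of x i] assms(3) by linarith
    then show "\<bar>(coordinatewise (push \<phi>) x - x) $ i\<bar> \<le> \<phi> R"
      using mono_onD[OF mono, of "\<bar>x $ i\<bar>" R] pos[of R] pos[of "\<bar>x $ i\<bar>"] \<open>R > 0\<close>
      by (cases "x $ i = 0") (auto simp: coordinatewise_def push_def abs_mult abs_sgn_eq)
  qed
  finally show ?thesis by simp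
qed

text \<open>
  The inner product of the displacement with \<open>x\<close> is a sum of nonnegative terms
  \<open>\<phi> \<bar>x\<^sub>i\<bar> * \<bar>x\<^sub>i\<bar>\<close>. The largest coordinate, of modulus at least \<open>norm x / n\<close>, already contributes
  a fixed multiple of \<open>\<phi> (norm x) * norm x\<close>, so the push moves \<open>x\<close> radially by at least a fixed
  multiple of \<open>\<phi> (norm x)\<close>.
\<close>

lemma norm_push_ge:
  fixes x :: "real ^ 'n" and \<phi> :: "real \<Rightarrow> real"
  assumes pos: "\<And>t. t > 0 \<Longrightarrow> \<phi> t > 0" and mono: "mono_on {0<..} \<phi>"
    and conc: "concave_on {0<..} \<phi>" and "x \<noteq> 0"
  shows "norm x + \<phi> (norm x) / (2 * (real CARD('n))\<^sup>2) \<le> norm (coordinatewise (push \<phi>) x)"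
proof -
  define n where "n = real CARD('n)"
  define r where "r = norm x"
  have n1: "n \<ge> 1" by (simp add: n_def Suc_leI)
  have r0: "r > 0" using \<open>x \<noteq> 0\<close> by (simp add: r_def)
  obtain i where i: "r / n \<le> \<bar>x $ i\<bar>"
  proof (rule ccontr)
    assume "\<not> thesis"
    then have "\<bar>x $ i\<bar> < r / n" for i using that by (meson not_le)
    then have "(\<Sum>i\<in>UNIV. \<bar>x $ i\<bar>) < (\<Sum>i\<in>(UNIV :: 'n set). r / n)"
      by (intro sum_strict_mono) auto
    also have "\<dots> = r" using n1 by (simp add: n_def)
    finally show False using norm_le_l1_cart[of x] by (simp add: r_def)
  qed
  have "\<phi> r / (2 * n) \<le> \<phi> (r / n)" by (rule concave_pos_scale[OF pos conc n1 r0])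
  also have "\<dots> \<le> \<phi> \<bar>x $ i\<bar>"
    using mono_onD[OF mono, of "r / n" "\<bar>x $ i\<bar>"] i n1 r0
    by (smt (verit) divide_pos_pos greaterThan_iff)
  finally have ph: "\<phi> r / (2 * n) \<le> \<phi> \<bar>x $ i\<bar>" .
  have "\<phi> r / (2 * n\<^sup>2) * r = (\<phi> r / (2 * n)) * (r / n)"
    by (simp add: power2_eq_square)
  also have "\<dots> \<le> \<phi> \<bar>x $ i\<bar> * \<bar>x $ i\<bar>"
    using ph i n1 r0 pos[OF r0] by (intro mult_mono) (auto intro: order_trans[OF _ ph])
  also have "\<dots> \<le> (\<Sum>j\<in>UNIV. \<phi> \<bar>x $ j\<bar> * \<bar>x $ j\<bar>)"
  proof (rule member_le_sum)
    show "0 \<le> \<phi> \<bar>x $ j\<bar> * \<bar>x $ j\<bar>" for j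
      using pos[of "\<bar>x $ j\<bar>"] by (cases "x $ j = 0") auto
  qed auto
  also have "\<dots> = inner (coordinatewise (push \<phi>) x) x - r\<^sup>2"
  proof -
    have "inner (coordinatewise (push \<phi>) x) x - inner x x = (\<Sum>j\<in>UNIV. \<phi> \<bar>x $ j\<bar> * \<bar>x $ j\<bar>)"
      unfolding inner_vec_def sum_subtractf[symmetric]
      by (rule sum.cong) (auto simp: coordinatewise_def push_def sgn_if algebra_simps abs_if)
    then show ?thesis by (simp add: r_def power2_norm_eq_inner)
  qed
  also have "\<dots> \<le> norm (coordinatewise (push \<phi>) x) * r - r\<^sup>2"
    by (simp add: r_def norm_cauchy_schwarz)
  finally have "(r + \<phi> r / (2 * n\<^sup>2)) * r \<le> norm (coordinatewise (push \<phi>) x) * r"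
    by (simp add: algebra_simps power2_eq_square)
  then show ?thesis using r0 by (simp add: r_def n_def)
qed

section \<open>Comparison of the two notions\<close>

lemma displacement_equivalent_bigo:
  assumes "displacement_equivalent \<phi> X Y" and "\<phi> \<in> O[at_top](\<psi>)"
  shows "displacement_equivalent \<psi> X Y"
  using assms unfolding displacement_equivalent_def by (blast intro: landau_o.big_trans)

lemma norm_le_disp:
  assumes "separated_set X" and "x \<in> X" and "norm x \<le> R"
  shows "norm (f x - x) \<le> disp X f R"
proof -
  have x: "x \<in> X \<inter> cball 0 R" using assms by simp
  then have "norm (f x - x) \<le> (SUP x \<in> X \<inter> cball 0 R. norm (f x - x))"
    using finite_separated_cball[OF assms(1), of R]
    by (intro cSUP_upper bdd_above_finite finite_imageI)
  then show ?thesis using x by (auto simp: disp_def)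
qed

lemma inj_coordinatewise_push:
  assumes "\<And>t. t > 0 \<Longrightarrow> \<phi> t > 0" and "mono_on {0<..} \<phi>"
  shows "inj (coordinatewise (push \<phi>) :: real ^ 'n \<Rightarrow> real ^ 'n)"
proof (rule injI)
  fix x y :: "real ^ 'n"
  assume "coordinatewise (push \<phi>) x = coordinatewise (push \<phi>) y"
  then have "push \<phi> (x $ i) = push \<phi> (y $ i)" for i
    by (simp add: coordinatewise_def vec_eq_iff)
  then have "\<bar>x $ i - y $ i\<bar> \<le> 0" for i
    using push_expanding[OF assms, of "x $ i" "y $ i"] by simp
  then show "x = y" by (simp add: vec_eq_iff)
qed

lemma displacement_equivalent_push:
  assumes pos: "\<And>t. t > 0 \<Longrightarrow> \<phi> t > 0" and mono: "mono_on {0<..} \<phi>"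
  shows "displacement_equivalent \<phi> (integer_lattice :: (real ^ 'n) set)
    (coordinatewise (push \<phi>) ` integer_lattice)"
proof -
  let ?X = "integer_lattice :: (real ^ 'n) set"
    and ?g = "coordinatewise (push \<phi>) :: real ^ 'n \<Rightarrow> real ^ 'n"
  have "bij_betw ?g ?X (?g ` ?X)"
    by (rule inj_on_imp_bij_betw, rule inj_on_subset[OF inj_coordinatewise_push[OF assms]]) auto
  moreover have "(\<lambda>R. disp ?X ?g R) \<in> O[at_top](\<phi>)"
  proof (rule bigoI[of _ "real CARD('n)"])
    have "norm (disp ?X ?g R) \<le> real CARD('n) * norm (\<phi> R)" if "R > 0" for R
    proof -
      have 0: "0 \<in> ?X" by (simp add: integer_lattice_def)
      have "norm (?g 0 - 0) \<le> disp ?X ?g R"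
        by (rule norm_le_disp[OF separated_set_integer_lattice 0]) (use that in simp)
      then have "0 \<le> disp ?X ?g R" by (rule order_trans[OF norm_ge_zero])
      moreover have "disp ?X ?g R \<le> real CARD('n) * \<phi> R"
      proof -
        have ne: "?X \<inter> cball 0 R \<noteq> {}" using 0 that by force
        have "(SUP x \<in> ?X \<inter> cball 0 R. norm (?g x - x)) \<le> real CARD('n) * \<phi> R"
          by (rule cSUP_least[OF ne]) (use that in \<open>auto intro!: norm_push_diff_le[OF pos mono]\<close>)
        then show ?thesis using ne by (simp add: disp_def)
      qed
      ultimately show ?thesis using pos[OF that] by simp
    qed
    then show "\<forall>\<^sub>F R in at_top. norm (disp ?X ?g R) \<le> real CARD('n) * norm (\<phi> R)"
      by (rule eventually_mono[OF eventually_gt_at_top[of 0]])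
  qed
  ultimately show ?thesis
    unfolding displacement_equivalent_def by (intro exI[of _ ?g] conjI)
qed

text \<open>
  The counting argument, for a bijection \<open>f\<close> with displacement \<open>o(\<phi>)\<close>. At a large integer radius \<open>R\<close>
  its displacement is less than the radial gain \<open>c * \<phi> R\<close> of the push, so every \<open>f x\<close> with \<open>x\<close> in the
  closed ball is the push of a lattice point \<open>z\<close> in the open ball.
\<close>

lemma not_displacement_equivalent_push:
  assumes pos: "\<And>t. t > 0 \<Longrightarrow> \<phi> t > 0" and mono: "mono_on {0<..} \<phi>"
    and conc: "concave_on {0<..} \<phi>" and small: "\<psi> \<in> o[at_top](\<phi>)"
  shows "\<not> displacement_equivalent \<psi> (integer_lattice :: (real ^ 'n) set)
    (coordinatewise (push \<phi>) ` integer_lattice)"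
proof
  let ?X = "integer_lattice :: (real ^ 'n) set"
    and ?g = "coordinatewise (push \<phi>) :: real ^ 'n \<Rightarrow> real ^ 'n"
  define c where "c = 1 / (2 * (real CARD('n))\<^sup>2)"
  assume "displacement_equivalent \<psi> ?X (?g ` ?X)"
  then obtain f where f: "bij_betw f ?X (?g ` ?X)" and big: "(\<lambda>R. disp ?X f R) \<in> O[at_top](\<psi>)"
    by (auto simp: displacement_equivalent_def)
  from big small have "(\<lambda>R. disp ?X f R) \<in> o[at_top](\<phi>)" by (rule landau_o.big_small_trans)
  moreover have c0: "c / 2 > 0" by (simp add: c_def)
  ultimately have "\<forall>\<^sub>F R in at_top. norm (disp ?X f R) \<le> c / 2 * norm (\<phi> R)"
    by (rule landau_o.smallD)
  then obtain R\<^sub>0 where R\<^sub>0: "\<And>R. R \<ge> R\<^sub>0 \<Longrightarrow> norm (disp ?X f R) \<le> c / 2 * norm (\<phi> R)"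
    by (auto simp: eventually_at_top_linorder)
  define m where "m = nat \<lceil>max R\<^sub>0 1\<rceil>"
  define R where "R = real m"
  have R: "R \<ge> R\<^sub>0" "R \<ge> 1" unfolding R_def m_def by linarith+
  have phR: "\<phi> R > 0" using pos R by simp
  have small_disp: "disp ?X f R < c * \<phi> R"
  proof -
    have "disp ?X f R \<le> c / 2 * \<phi> R" using R\<^sub>0[OF R(1)] phR by simp
    also have "\<dots> < c * \<phi> R" using phR c0 by simp
    finally show ?thesis .
  qed
  have sep: "separated_set ?X" by (rule separated_set_integer_lattice)
  have image: "f ` (?X \<inter> cball 0 R) \<subseteq> ?g ` (?X \<inter> ball 0 R)"
  proof
    fix y assume "y \<in> f ` (?X \<inter> cball 0 R)"
    then obtain x where x: "x \<in> ?X" "norm x \<le> R" "y = f x" by auto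
    obtain z where z: "z \<in> ?X" "y = ?g z" using x f by (auto simp: bij_betw_def)
    have "norm (f x - x) \<le> disp ?X f R" by (rule norm_le_disp[OF sep x(1,2)])
    then have lt: "norm y < R + c * \<phi> R"
      using small_disp norm_triangle_sub[of y x] x by simp
    have "norm z < R"
    proof (rule ccontr)
      assume "\<not> norm z < R"
      then have le: "R \<le> norm z" by simp
      then have z0: "z \<noteq> 0" using R by auto
      from le have "\<phi> R \<le> \<phi> (norm z)"
        using R by (intro mono_onD[OF mono]) auto
      then have "c * \<phi> R \<le> c * \<phi> (norm z)" using c0 by (intro mult_left_mono) auto
      moreover have "norm z + c * \<phi> (norm z) \<le> norm y"
        using norm_push_ge[OF pos mono conc z0] z by (simp add: c_def)
      ultimately show False using lt le by linarith
    qed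
    then show "y \<in> ?g ` (?X \<inter> ball 0 R)" using z by auto
  qed
  have fin: "finite (?X \<inter> cball 0 R)" by (rule finite_separated_cball[OF sep])
  have finb: "finite (?X \<inter> ball 0 R)" by (rule finite_subset[OF _ fin]) auto
  have "card (?X \<inter> cball 0 R) = card (f ` (?X \<inter> cball 0 R))"
    using f by (intro card_image[symmetric]) (auto simp: bij_betw_def intro: inj_on_subset)
  also have "\<dots> \<le> card (?X \<inter> ball 0 R)"
    using card_mono[OF finite_imageI[OF finb] image] card_image_le[OF finb, of ?g] by linarith
  also have "\<dots> < card (?X \<inter> cball 0 R)"
  proof (rule psubset_card_mono[OF fin])
    \<comment> \<open>Since \<open>R\<close> is an integer, a multiple of a unit vector is a lattice point on the sphere.\<close>
    have "axis undefined R \<in> ?X" by (simp add: integer_lattice_def axis_def R_def)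
    moreover have "norm (axis undefined R :: real ^ 'n) = R" using R by (simp add: norm_eq_sqrt_inner inner_axis_axis)
    ultimately show "?X \<inter> ball 0 R \<subset> ?X \<inter> cball 0 R" by force
  qed
  finally show False by simp
qed

theorem corollary1p7:
  fixes \<phi>\<^sub>1 \<phi>\<^sub>2 :: "real \<Rightarrow> real"
  assumes "\<And>R. R > 0 \<Longrightarrow> \<phi>\<^sub>1 R > 0" and "\<And>R. R > 0 \<Longrightarrow> \<phi>\<^sub>2 R > 0"
    and "mono_on {0<..} \<phi>\<^sub>1" and "mono_on {0<..} \<phi>\<^sub>2"
    and "concave_on {0<..} \<phi>\<^sub>1" and "concave_on {0<..} \<phi>\<^sub>2"
    and "\<phi>\<^sub>1 \<in> o[at_top](\<phi>\<^sub>2)"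
  shows "(\<forall>X Y :: (real ^ 'n) set. separated_net X \<longrightarrow> separated_net Y \<longrightarrow>
            displacement_equivalent \<phi>\<^sub>1 X Y \<longrightarrow> displacement_equivalent \<phi>\<^sub>2 X Y) \<and>
         (\<exists>X Y :: (real ^ 'n) set. separated_net X \<and> separated_net Y \<and>
            displacement_equivalent \<phi>\<^sub>2 X Y \<and> \<not> displacement_equivalent \<phi>\<^sub>1 X Y)"
proof -
  have "displacement_equivalent \<phi>\<^sub>2 X Y" if "displacement_equivalent \<phi>\<^sub>1 X Y"
    for X Y :: "(real ^ 'n) set"
    using that landau_o.small_imp_big[OF assms(7)] by (rule displacement_equivalent_bigo)
  moreover have "separated_net (coordinatewise (push \<phi>\<^sub>2) ` (integer_lattice :: (real ^ 'n) set))"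
  proof (rule separated_net_coordinatewise)
    fix s t :: real assume "s \<in> \<int>" "t \<in> \<int>" "s \<noteq> t"
    then have "1 \<le> \<bar>s - t\<bar>" by (metis Ints_diff Ints_nonzero_abs_ge1 right_minus_eq)
    also have "\<dots> \<le> \<bar>push \<phi>\<^sub>2 s - push \<phi>\<^sub>2 t\<bar>" by (rule push_expanding[OF assms(2,4)])
    finally show "1 \<le> \<bar>push \<phi>\<^sub>2 s - push \<phi>\<^sub>2 t\<bar>" .
  qed (rule push_dense[OF assms(2,4,6)])
  ultimately show ?thesis
    using separated_net_integer_lattice displacement_equivalent_push[OF assms(2,4)]
      not_displacement_equivalent_push[OF assms(2,4,6,7)] by blast
qed

end
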